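(* There exist locally checkable problems with the following round complexities in $n$-node graphs in the LOCAL model: (i) $\Theta(\log^\star n)$; (ii) $\Theta(\log^{\epsilon} n)$, for every real $\epsilon\in(0,1)$; (iii) $\Theta(\log^{(k)} n)$, for every integer $k\ge 1$. In all cases, the lower bounds also hold when the input graphs are restricted to be trees.
   Context: Notation. Logarithms are in base $2$; $\log^{\epsilon}n=(\log n)^{\epsilon}$; $\log^{(k)}$ is the $k$-th iterate of $\log$ ($\log^{(1)}=\log$, $\log^{(k)}=\log\circ\log^{(k-1)}$); $\log^\star n$ is the number of times $\log$ must be applied to $n$ until the result is at most $1$. LOCAL model. The network is a simple connected graph $G=(V,E)$ with $n\ge 1$ nodes. Each node $v$ has an identifier $\mathrm{id}(v)\in[0,N]$, unique in the network, where $N$ is an upper bound on $n$ that is polynomial in $n$; $N$ may be given to the nodes. Initially a node knows only its identifier, its degree and its input label (and $N$), and nothing else about the graph. Computation proceeds in synchronous rounds, all nodes starting at the same round; in each round every node performs arbitrary local computation, sends a message of arbitrary size to each neighbor, and receives its neighbors' messages. Each node eventually outputs a label. The round complexity of a (deterministic) algorithm is the function of $n$ giving the maximum, over all $n$-node graphs (and all identifier and input assignments), of the number of rounds until all nodes have output. Locally checkable problem. A pair $(L,\varphi)$ where $L$ is a finite set of labels and $\varphi$ is a Boolean predicate on $L$-labeled balls of radius $r$ (for some fixed integer $r\ge 0$) in arbitrary graphs (no bound on the degrees); the ball of radius $r$ centered at $v$ is the subgraph induced by the nodes at distance at most $r$ from $v$. Input labels are allowed: $L=L_{in}\times L_{out}$,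 each node $v$ receives an arbitrary $\ell_{in}(v)\in L_{in}$ and must output $\ell_{out}(v)\in L_{out}$. An algorithm solves the problem if for every input graph and every input labeling the produced labeling is such that the labeled ball of radius $r$ around every node satisfies $\varphi$. A problem has round complexity $\Theta(t(n))$ if some algorithm solves it in $O(t(n))$ rounds and every algorithm solving it has round complexity $\Omega(t(n))$. The lower bound holds for trees if every algorithm solving the problem on all trees needs $\Omega(t(n))$ rounds in the worst case over $n$-node trees. *)

theory Defs
  imports
    Complex_Main
    "HOL-Library.Extended_Nat"
    "HOL-Library.Landau_Symbols"
    "Graph_Theory.Digraph_Component"
begin

section \<open>Iterated logarithms\<close>

definition iter_log :: "nat \<Rightarrow> real \<Rightarrow> real" where
  "iter_log k x = (log 2 ^^ k) x"

definition log_star :: "nat \<Rightarrow> nat" where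
  "log_star n = (LEAST k. iter_log k (real n) \<le> 1)"


section \<open>Graphs\<close>

text \<open>
  Simple graphs are finite, symmetric, loop-free digraphs without parallel arcs
  (\<^const>\<open>pair_graph\<close>). Nodes are natural numbers; they only serve as names, are not visible to
  the algorithms, and are unrelated to the identifiers.
\<close>

type_synonym ugraph = "nat pair_pre_digraph"

text \<open>\<^const>\<open>Digraph_Component.connected\<close> excludes the empty graph.\<close>

definition connected_graph :: "ugraph \<Rightarrow> bool" where
  "connected_graph G \<longleftrightarrow> pair_graph G \<and> Digraph_Component.connected (with_proj G)"

definition nbrs :: "ugraph \<Rightarrow> nat \<Rightarrow> nat set" where
  "nbrs G v = {u. (v, u) \<in> parcs G}"

text \<open>
  \<^const>\<open>Digraph_Component.tree\<close> is of no use here: in a symmetric digraph it regards every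
  edge, traversed back and forth, as a cycle.
\<close>

definition tree_graph :: "ugraph \<Rightarrow> bool" where
  "tree_graph G \<longleftrightarrow> connected_graph G \<and>
     (\<nexists>c. 3 \<le> length c \<and> distinct c \<and>
        (\<forall>i < length c. (c ! i, c ! (Suc i mod length c)) \<in> parcs G))"

definition ball_nodes :: "ugraph \<Rightarrow> nat \<Rightarrow> nat \<Rightarrow> nat set" where
  "ball_nodes G r v = {u. \<exists>k \<le> r. (v, u) \<in> parcs G ^^ k}"

definition graph_ball :: "ugraph \<Rightarrow> nat \<Rightarrow> nat \<Rightarrow> ugraph" where
  "graph_ball G r v =
     \<lparr>pverts = ball_nodes G r v, parcs = parcs G \<inter> (ball_nodes G r v \<times> ball_nodes G r v)\<rparr>"


section \<open>Locally checkable problems\<close>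

text \<open>
  Labels are pairs of an input and an output label, both coded as natural numbers. The predicate
  takes a graph, a center and a labeling.
\<close>

record problem =
  in_labels :: "nat set"
  out_labels :: "nat set"
  radius :: nat
  good_ball :: "ugraph \<Rightarrow> nat \<Rightarrow> (nat \<Rightarrow> nat \<times> nat) \<Rightarrow> bool"

definition labeled_iso ::
  "(nat \<Rightarrow> nat) \<Rightarrow> ugraph \<Rightarrow> nat \<Rightarrow> (nat \<Rightarrow> nat \<times> nat) \<Rightarrow>
   ugraph \<Rightarrow> nat \<Rightarrow> (nat \<Rightarrow> nat \<times> nat) \<Rightarrow> bool" where
  "labeled_iso f G c l G' c' l' \<longleftrightarrow>
     bij_betw f (pverts G) (pverts G') \<and> f c = c' \<and>
     (\<forall>x \<in> pverts G. \<forall>y \<in> pverts G. (x, y) \<in> parcs G \<longleftrightarrow> (f x, f y) \<in> parcs G') \<and>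
     (\<forall>x \<in> pverts G. l' (f x) = l x)"

text \<open>
  Invariance under isomorphism says that the predicate depends on nothing but the labeled ball:
  neither on the names of the nodes nor on the values of the labeling outside of the ball.
\<close>

definition locally_checkable :: "problem \<Rightarrow> bool" where
  "locally_checkable P \<longleftrightarrow>
     finite (in_labels P) \<and> finite (out_labels P) \<and>
     (\<forall>f G c l G' c' l'.
        pair_graph G \<and> pair_graph G' \<and> c \<in> pverts G \<and> labeled_iso f G c l G' c' l' \<longrightarrow>
        (good_ball P G c l \<longleftrightarrow> good_ball P G' c' l'))"


section \<open>The LOCAL model\<close>

record network =
  topology :: ugraph
  id_bound :: nat
  ident :: "nat \<Rightarrow> nat"
  input :: "nat \<Rightarrow> nat"

text \<open>
  Local computations are arbitrary functions on states and messages, which are coded as natural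
  numbers. This is no restriction on state space or message size: there are only countably many
  initial states (one for each bound, identifier, degree and input label), and hence countably
  many states and messages that ever occur.

  A node addresses its neighbors by their identifiers, and a received message is tagged with the
  identifier of its sender. This reveals nothing in advance: the state of a node does not contain
  the identifiers of its neighbors before the first round, a recipient knows its own identifier,
  and a sender could always include its own one in the message.

  A node outputs at the first time at which \<open>out\<close> is defined on its state. From then on its output
  is fixed, but it continues to take part in the communication.
\<close>

record algorithm =
  init :: "nat \<Rightarrow> nat \<Rightarrow> nat \<Rightarrow> nat \<Rightarrow> nat" \<comment> \<open>bound \<open>N\<close>, own identifier, degree, input label\<close>
  send :: "nat \<Rightarrow> nat \<Rightarrow> nat" \<comment> \<open>state, identifier of the recipient\<close>
  receive :: "nat \<Rightarrow> (nat \<times> nat) set \<Rightarrow> nat" \<comment> \<open>state, pairs of sender identifier and message\<close>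
  out :: "nat \<Rightarrow> nat option"

primrec node_state :: "algorithm \<Rightarrow> network \<Rightarrow> nat \<Rightarrow> nat \<Rightarrow> nat" where
  "node_state A I 0 v =
     init A (id_bound I) (ident I v) (card (nbrs (topology I) v)) (input I v)"
| "node_state A I (Suc t) v =
     receive A (node_state A I t v)
       ((\<lambda>u. (ident I u, send A (node_state A I t u) (ident I v))) ` nbrs (topology I) v)"

definition has_output :: "algorithm \<Rightarrow> network \<Rightarrow> nat \<Rightarrow> nat \<Rightarrow> bool" where
  "has_output A I t v \<longleftrightarrow> (\<exists>s \<le> t. out A (node_state A I s v) \<noteq> None)"

definition output_label :: "algorithm \<Rightarrow> network \<Rightarrow> nat \<Rightarrow> nat" where
  "output_label A I v = the (out A (node_state A I (LEAST t. has_output A I t v) v))"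

text \<open>The number of rounds is \<open>\<infinity>\<close> if some node never outputs.\<close>

definition rounds :: "algorithm \<Rightarrow> network \<Rightarrow> enat" where
  "rounds A I = (INF t \<in> {t. \<forall>v \<in> pverts (topology I). has_output A I t v}. enat t)"

text \<open>
  The set \<open>B n\<close> contains the values that \<open>N\<close> may take in \<open>n\<close>-node networks. This covers both
  a fixed polynomially bounded function \<open>N(n)\<close> (singletons) and a bound that varies among
  networks with the same number of nodes.
\<close>

definition poly_bounds :: "(nat \<Rightarrow> nat set) \<Rightarrow> bool" where
  "poly_bounds B \<longleftrightarrow>
     (\<exists>a c. \<forall>n \<ge> 1. B n \<noteq> {} \<and> (\<forall>N \<in> B n. n \<le> N \<and> N \<le> a * n ^ c))"

definition networks ::
  "(ugraph \<Rightarrow> bool) \<Rightarrow> (nat \<Rightarrow> nat set) \<Rightarrow> nat set \<Rightarrow> nat \<Rightarrow> network set" where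
  "networks C B L n =
     {I. connected_graph (topology I) \<and> C (topology I) \<and> card (pverts (topology I)) = n \<and>
         id_bound I \<in> B n \<and>
         inj_on (ident I) (pverts (topology I)) \<and>
         ident I ` pverts (topology I) \<subseteq> {0..id_bound I} \<and>
         input I ` pverts (topology I) \<subseteq> L}"

definition solves :: "algorithm \<Rightarrow> problem \<Rightarrow> (ugraph \<Rightarrow> bool) \<Rightarrow> (nat \<Rightarrow> nat set) \<Rightarrow> bool" where
  "solves A P C B \<longleftrightarrow>
     (\<forall>n. \<forall>I \<in> networks C B (in_labels P) n. \<forall>v \<in> pverts (topology I).
        (\<exists>t. has_output A I t v) \<and>
        output_label A I v \<in> out_labels P \<and>
        good_ball P (graph_ball (topology I) (radius P) v) v
          (\<lambda>u. (input I u, output_label A I u)))"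

definition round_complexity ::
  "algorithm \<Rightarrow> problem \<Rightarrow> (ugraph \<Rightarrow> bool) \<Rightarrow> (nat \<Rightarrow> nat set) \<Rightarrow> nat \<Rightarrow> enat" where
  "round_complexity A P C B n = (SUP I \<in> networks C B (in_labels P) n. rounds A I)"

definition solvable_in ::
  "problem \<Rightarrow> (ugraph \<Rightarrow> bool) \<Rightarrow> (nat \<Rightarrow> nat set) \<Rightarrow> (nat \<Rightarrow> real) \<Rightarrow> bool" where
  "solvable_in P C B t \<longleftrightarrow>
     (\<exists>A. solves A P C B \<and>
        (\<exists>T. (\<forall>n. round_complexity A P C B n \<le> enat (T n)) \<and> (\<lambda>n. real (T n)) \<in> O(t)))"

definition requires ::
  "problem \<Rightarrow> (ugraph \<Rightarrow> bool) \<Rightarrow> (nat \<Rightarrow> nat set) \<Rightarrow> (nat \<Rightarrow> real) \<Rightarrow> bool" where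
  "requires P C B t \<longleftrightarrow>
     (\<forall>A. solves A P C B \<longrightarrow>
        (\<exists>T. (\<forall>n. enat (T n) \<le> round_complexity A P C B n) \<and> (\<lambda>n. real (T n)) \<in> \<Omega>(t)))"

definition has_complexity_Theta :: "problem \<Rightarrow> (nat \<Rightarrow> real) \<Rightarrow> bool" where
  "has_complexity_Theta P t \<longleftrightarrow>
     (\<forall>B. poly_bounds B \<longrightarrow> solvable_in P (\<lambda>G. True) B t \<and> requires P (\<lambda>G. True) B t)"

definition lower_bound_for_trees :: "problem \<Rightarrow> (nat \<Rightarrow> real) \<Rightarrow> bool" where
  "lower_bound_for_trees P t \<longleftrightarrow> (\<forall>B. poly_bounds B \<longrightarrow> requires P tree_graph B t)"

end

theory Submission
  imports
    Defs
    "HOL-Library.Nat_Bijection"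
    "HOL-Library.Discrete_Functions"
    "HOL-Real_Asymp.Real_Asymp"
begin

text \<open>
  Since degrees are unbounded, a degree can encode a position. Fix a slowly growing monotone function
  \<open>s\<close> and call \<open>s (deg v)\<close> the level of \<open>v\<close>. A node must output 1 iff its input is 1 or some neighbor
  of higher level outputs 1; the output thus says whether an input 1 is reachable along a path of
  increasing levels. Such a path has at most \<open>s n\<close> steps, so flooding for \<open>s N = O(s n)\<close> rounds
  suffices, provided that \<open>s (n\<^sup>2) = O(s n)\<close>. Conversely, with only \<open>m\<^sup>2\<close> nodes one can attach leaves
  to a path of about \<open>s m = \<Omega>(s n)\<close> nodes such that the levels along it are increasing, and then the
  lowest node of the path has to learn the input of the highest one. The theorem follows by taking for
  \<open>s\<close> the integer part of the respective complexity.
\<close>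

section \<open>The upward reachability problem\<close>

definition higher_nbrs :: "(nat \<Rightarrow> nat) \<Rightarrow> ugraph \<Rightarrow> nat \<Rightarrow> nat set" where
  "higher_nbrs s G v = {u \<in> nbrs G v. s (card (nbrs G v)) < s (card (nbrs G u))}"

text \<open>Radius 2 makes the full degrees of the center's neighbors visible in the ball. As levels
  strictly increase along \<open>higher_nbrs\<close>, the rule has a unique 0-1 solution on every
  finite graph.\<close>

definition level_problem :: "(nat \<Rightarrow> nat) \<Rightarrow> problem" where
  "level_problem s =
     \<lparr>in_labels = {0, 1}, out_labels = {0, 1}, radius = 2,
      good_ball = \<lambda>G c l. snd (l c) = 1 \<longleftrightarrow>
        fst (l c) = 1 \<or> (\<exists>u \<in> higher_nbrs s G c. snd (l u) = 1)\<rparr>"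

lemma level_problem_simps [simp]:
  "in_labels (level_problem s) = {0, 1}"
  "out_labels (level_problem s) = {0, 1}"
  "radius (level_problem s) = 2"
  "good_ball (level_problem s) G c l \<longleftrightarrow>
     (snd (l c) = 1 \<longleftrightarrow> fst (l c) = 1 \<or> (\<exists>u \<in> higher_nbrs s G c. snd (l u) = 1))"
  by (simp_all add: level_problem_def)

lemma pair_graph_nbrs:
  assumes "pair_graph G"
  shows "nbrs G v \<subseteq> pverts G" "finite (nbrs G v)"
proof -
  interpret pair_graph G by fact
  show "nbrs G v \<subseteq> pverts G" by (auto simp: nbrs_def dest: in_arcsD2)
  then show "finite (nbrs G v)" using pair_finite_verts finite_subset by blast
qed

text \<open>An isomorphism carries neighborhoods to neighborhoods and so preserves degrees, levels
  and the higher neighbors.\<close>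

lemma locally_checkable_level_problem: "locally_checkable (level_problem s)"
proof -
  have "good_ball (level_problem s) G c l \<longleftrightarrow> good_ball (level_problem s) G' c' l'"
    if G: "pair_graph G" and G': "pair_graph G'" and c: "c \<in> pverts G"
      and iso: "labeled_iso f G c l G' c' l'" for f G c l G' c' l'
  proof -
    have bij: "bij_betw f (pverts G) (pverts G')" and [simp]: "c' = f c"
      and arc: "\<And>x y. x \<in> pverts G \<Longrightarrow> y \<in> pverts G \<Longrightarrow> (x, y) \<in> parcs G \<longleftrightarrow> (f x, f y) \<in> parcs G'"
      and lab: "\<And>x. x \<in> pverts G \<Longrightarrow> l' (f x) = l x"
      using iso by (auto simp: labeled_iso_def)
    have nbrs: "nbrs G' (f x) = f ` nbrs G x" if "x \<in> pverts G" for x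
    proof (intro equalityI subsetI)
      fix y assume y: "y \<in> nbrs G' (f x)"
      then have "y \<in> pverts G'" using pair_graph_nbrs[OF G'] by blast
      then obtain z where "z \<in> pverts G" "y = f z" using bij by (auto simp: bij_betw_def)
      then show "y \<in> f ` nbrs G x" using y arc[OF that] by (auto simp: nbrs_def)
    next
      fix y assume "y \<in> f ` nbrs G x"
      then obtain z where "z \<in> nbrs G x" "y = f z" by blast
      moreover from this have "z \<in> pverts G" using pair_graph_nbrs[OF G] by blast
      ultimately show "y \<in> nbrs G' (f x)" using arc[OF that] by (auto simp: nbrs_def)
    qed
    have card: "card (nbrs G' (f x)) = card (nbrs G x)" if "x \<in> pverts G" for x
      unfolding nbrs[OF that] using bij pair_graph_nbrs[OF G]
      by (intro card_image) (auto simp: bij_betw_def intro: inj_on_subset)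
    have sub: "u \<in> pverts G" if "u \<in> nbrs G c" for u
      using that pair_graph_nbrs[OF G] by blast
    have "higher_nbrs s G' c' = f ` higher_nbrs s G c"
      unfolding higher_nbrs_def \<open>c' = f c\<close> card[OF c] unfolding nbrs[OF c]
      using sub card by auto
    moreover have "snd (l' (f u)) = snd (l u)" if "u \<in> higher_nbrs s G c" for u
      using that sub lab by (auto simp: higher_nbrs_def)
    ultimately show ?thesis
      using lab[OF c] by auto
  qed
  then show ?thesis
    unfolding locally_checkable_def level_problem_simps(1,2) by blast
qed

text \<open>The neighbors of the center and all their neighbors lie in the ball, so cutting it out
  changes none of the degrees compared.\<close>

lemma higher_nbrs_graph_ball: "higher_nbrs s (graph_ball G 2 v) v = higher_nbrs s G v"
proof -
  have in0: "v \<in> ball_nodes G 2 v"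
    unfolding ball_nodes_def by (auto intro!: exI[of _ 0])
  have in1: "u \<in> ball_nodes G 2 v" if "u \<in> nbrs G v" for u
    using that unfolding ball_nodes_def nbrs_def by (auto intro!: exI[of _ 1])
  have in2: "w \<in> ball_nodes G 2 v" if "u \<in> nbrs G v" "w \<in> nbrs G u" for u w
    using that unfolding ball_nodes_def nbrs_def
    by (auto intro!: exI[of _ 2] simp: numeral_2_eq_2)
  have "nbrs (graph_ball G 2 v) v = nbrs G v"
    using in0 in1 by (auto simp: nbrs_def graph_ball_def)
  moreover have "nbrs (graph_ball G 2 v) u = nbrs G u" if "u \<in> nbrs G v" for u
    using in1[OF that] in2[OF that] by (auto simp: nbrs_def graph_ball_def)
  ultimately show ?thesis
    by (auto simp: higher_nbrs_def)
qed

section \<open>Upper bound\<close>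

definition enc :: "nat \<Rightarrow> nat \<Rightarrow> nat \<Rightarrow> bool \<Rightarrow> nat" where
  "enc r l x b = list_encode [r, l, x, of_bool b]"

definition remaining :: "nat \<Rightarrow> nat" where "remaining st = list_decode st ! 0"
definition level :: "nat \<Rightarrow> nat" where "level st = list_decode st ! 1"
definition own_input :: "nat \<Rightarrow> nat" where "own_input st = list_decode st ! 2"
definition flag :: "nat \<Rightarrow> bool" where "flag st \<longleftrightarrow> list_decode st ! 3 = 1"

lemma enc_simps [simp]:
  "remaining (enc r l x b) = r" "level (enc r l x b) = l"
  "own_input (enc r l x b) = x" "flag (enc r l x b) = b"
  by (simp_all add: enc_def remaining_def level_def own_input_def flag_def)

text \<open>The bound \<open>N\<close> is common to all nodes, so all countdowns from
  \<open>s N\<close> end in the same round. The whole state is sent because the recipient compares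
  levels.\<close>

definition flood :: "(nat \<Rightarrow> nat) \<Rightarrow> algorithm" where
  "flood s =
     \<lparr>init = \<lambda>N i d x. enc (s N) (s d) x (x = 1),
      send = \<lambda>st i. st,
      receive = \<lambda>st M. enc (remaining st - 1) (level st) (own_input st)
        (own_input st = 1 \<or> (\<exists>(i, m) \<in> M. level st < level m \<and> flag m)),
      out = \<lambda>st. if remaining st = 0 then Some (of_bool (flag st)) else None\<rparr>"

primrec reach :: "(nat \<Rightarrow> nat) \<Rightarrow> network \<Rightarrow> nat \<Rightarrow> nat \<Rightarrow> bool" where
  "reach s I 0 v \<longleftrightarrow> input I v = 1"
| "reach s I (Suc t) v \<longleftrightarrow>
     input I v = 1 \<or> (\<exists>u \<in> higher_nbrs s (topology I) v. reach s I t u)"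

lemma node_state_flood:
  "node_state (flood s) I t v =
     enc (s (id_bound I) - t) (s (card (nbrs (topology I) v))) (input I v) (reach s I t v)"
proof (induction t arbitrary: v)
  case 0
  then show ?case by (simp add: flood_def)
next
  case (Suc t)
  show ?case
    unfolding node_state.simps Suc by (auto simp: flood_def higher_nbrs_def intro!: arg_cong[where f = "enc _ _ _"])
qed

lemma has_output_flood: "has_output (flood s) I t v \<longleftrightarrow> s (id_bound I) \<le> t"
proof -
  have "out (flood s) (node_state (flood s) I r v) \<noteq> None \<longleftrightarrow> s (id_bound I) \<le> r" for r
    unfolding node_state_flood by (simp add: flood_def)
  then show ?thesis
    unfolding has_output_def by (auto intro: order_trans)
qed

lemma output_label_flood:
  "output_label (flood s) I v = of_bool (reach s I (s (id_bound I)) v)"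
proof -
  have "(LEAST t. s (id_bound I) \<le> t) = s (id_bound I)"
    by (rule Least_equality) auto
  then show ?thesis
    unfolding output_label_def has_output_flood node_state_flood by (simp add: flood_def)
qed

text \<open>A chain of neighbors with increasing levels that starts at \<open>v\<close> has at most
  \<open>R - s (deg v)\<close> steps.\<close>

lemma reach_stable:
  assumes "\<And>u. s (card (nbrs (topology I) u)) \<le> R"
    and "R \<le> t + s (card (nbrs (topology I) v))"
  shows "reach s I (Suc t) v \<longleftrightarrow> reach s I t v"
  using assms(2)
proof (induction t arbitrary: v)
  case 0
  then have "higher_nbrs s (topology I) v = {}"
    unfolding higher_nbrs_def using assms(1) by (auto simp: not_less intro: le_trans)
  then show ?case by simp
next
  case (Suc t)
  \<comment> \<open>A higher neighbor gains at least one level, which pays for the step lost in the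
    induction.\<close>
  have "reach s I (Suc t) u \<longleftrightarrow> reach s I t u" if "u \<in> higher_nbrs s (topology I) v" for u
    using Suc.prems that by (intro Suc.IH) (auto simp: higher_nbrs_def)
  then show ?case by (simp only: reach.simps(2) cong: bex_cong)
qed

lemma networksD:
  assumes "I \<in> networks C B L n" "poly_bounds B"
  shows "pair_graph (topology I)" "card (pverts (topology I)) = n" "1 \<le> n" "id_bound I \<in> B n"
    "n \<le> id_bound I"
proof -
  show *: "pair_graph (topology I)" "card (pverts (topology I)) = n" "id_bound I \<in> B n"
    using assms(1) by (auto simp: networks_def connected_graph_def)
  interpret pair_graph "topology I" by fact
  have "pverts (topology I) \<noteq> {}"
    using assms(1)
    by (auto simp: networks_def connected_graph_def connected_def strongly_connected_def)
  then show n: "1 \<le> n"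
    using *(2) pair_finite_verts by (metis One_nat_def Suc_leI card_gt_0_iff)
  show "n \<le> id_bound I"
    using assms(2) n *(3) by (auto simp: poly_bounds_def)
qed

text \<open>Degrees are at most \<open>N\<close>, hence levels at most \<open>s N\<close>, and
  \<open>reach\<close> is stable when the nodes output. A stable \<open>reach\<close> is a fixed
  point of the local rule.\<close>

lemma flood_solves:
  assumes "mono s" "poly_bounds B"
  shows "solves (flood s) (level_problem s) C B"
  unfolding solves_def
proof (intro allI ballI conjI)
  fix n I v
  assume I: "I \<in> networks C B (in_labels (level_problem s)) n"
  note I' = networksD[OF I assms(2)]
  let ?R = "s (id_bound I)"
  show "\<exists>t. has_output (flood s) I t v"
    by (auto simp: has_output_flood)
  show "output_label (flood s) I v \<in> out_labels (level_problem s)"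
    by (simp add: output_label_flood)
  have "card (nbrs (topology I) u) \<le> id_bound I" for u
    using card_mono[OF _ pair_graph_nbrs(1)[OF I'(1), of u]] I'
    by (metis card_ge_0_finite le_trans less_le_trans zero_less_one)
  then have "s (card (nbrs (topology I) u)) \<le> ?R" for u
    using assms(1) by (simp add: monoD)
  from reach_stable[of s I ?R, OF this]
  have "reach s I (Suc ?R) v \<longleftrightarrow> reach s I ?R v"
    by simp
  then show "good_ball (level_problem s) (graph_ball (topology I) (radius (level_problem s)) v) v
      (\<lambda>u. (input I u, output_label (flood s) I u))"
    by (auto simp: output_label_flood higher_nbrs_graph_ball)
qed

lemma rounds_flood: "rounds (flood s) I \<le> enat (s (id_bound I))"
  unfolding rounds_def by (rule INF_lower) (simp add: has_output_flood)

text \<open>Each squaring costs one application of the hypothesis. Thus polynomial changes of the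
  argument cost only constant factors once \<open>s\<close> is positive.\<close>

lemma square_growth_iterate:
  fixes s :: "nat \<Rightarrow> nat"
  assumes "\<And>n. s (n\<^sup>2) \<le> C * s n + C"
  obtains D where "\<And>n. s (n ^ 2 ^ j) \<le> D * s n + D"
proof (induction j arbitrary: thesis)
  case 0
  show ?case by (rule 0[of 1]) simp
next
  case (Suc j)
  obtain D where D: "\<And>n. s (n ^ 2 ^ j) \<le> D * s n + D" using Suc.IH by blast
  have "s (n ^ 2 ^ Suc j) \<le> (C * D + C) * s n + (C * D + C)" for n
  proof -
    have "s (n ^ 2 ^ Suc j) = s ((n ^ 2 ^ j)\<^sup>2)"
      by (simp add: power_mult mult.commute flip: power_mult)
    also have "\<dots> \<le> C * s (n ^ 2 ^ j) + C" by (rule assms)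
    also have "\<dots> \<le> C * (D * s n + D) + C" using D by simp
    also have "\<dots> \<le> (C * D + C) * s n + (C * D + C)" by (simp add: algebra_simps)
    finally show ?thesis .
  qed
  then show ?case by (rule Suc.prems)
qed

lemma level_problem_upper:
  fixes s :: "nat \<Rightarrow> nat"
  assumes "mono s" "\<And>n. s (n\<^sup>2) \<le> C * s n + C" "filterlim s at_top sequentially"
    and "poly_bounds B"
  shows "solvable_in (level_problem s) G B (\<lambda>n. real (s n))"
proof -
  obtain a c where ac: "\<And>n N. 1 \<le> n \<Longrightarrow> N \<in> B n \<Longrightarrow> N \<le> a * n ^ c"
    using assms(4) unfolding poly_bounds_def by blast
  define T where "T n = s (a * n ^ c)" for n
  have "round_complexity (flood s) (level_problem s) G B n \<le> enat (T n)" for n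
    unfolding round_complexity_def
  proof (rule SUP_least)
    fix I assume I: "I \<in> networks G B (in_labels (level_problem s)) n"
    have "s (id_bound I) \<le> T n"
      unfolding T_def using networksD[OF I assms(4)] ac assms(1) by (simp add: monoD)
    with rounds_flood[of s I] show "rounds (flood s) I \<le> enat (T n)"
      by (meson enat_ord_simps(1) order_trans)
  qed
  moreover have "(\<lambda>n. real (T n)) \<in> O(\<lambda>n. real (s n))"
  proof -
    \<comment> \<open>One extra factor \<open>n\<close> absorbs \<open>a\<close> once
      \<open>a \<le> n\<close>, and \<open>2 ^ Suc c\<close> is an exponent above
      \<open>Suc c\<close> that repeated squaring reaches.\<close>
    obtain D where D: "\<And>n. s (n ^ 2 ^ Suc c) \<le> D * s n + D"
      using square_growth_iterate[of s C] assms(2) by blast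
    have "\<forall>\<^sub>F n in sequentially. 1 \<le> s n"
      using assms(3) by (simp add: filterlim_at_top)
    then have "\<forall>\<^sub>F n in sequentially. norm (real (T n)) \<le> real (2 * D) * norm (real (s n))"
      using eventually_ge_at_top[of "max a 1"]
    proof eventually_elim
      case (elim n)
      have "a * n ^ c \<le> n ^ Suc c" using elim by simp
      also have "\<dots> \<le> n ^ 2 ^ Suc c"
        using elim less_exp[of "Suc c"] by (intro power_increasing) (simp_all del: power_Suc)
      finally have "T n \<le> D * s n + D"
        unfolding T_def using D[of n] assms(1) by (meson monoD order_trans)
      also have "\<dots> \<le> 2 * D * s n" using elim by simp
      finally show ?case by (metis norm_of_nat of_nat_le_iff of_nat_mult)
    qed
    then show ?thesis by (rule bigoI)
  qed
  ultimately show ?thesis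
    unfolding solvable_in_def using flood_solves[OF assms(1,4)] by blast
qed

section \<open>Lower bound\<close>

definition parent_graph :: "nat \<Rightarrow> (nat \<Rightarrow> nat) \<Rightarrow> ugraph" where
  "parent_graph n p =
     \<lparr>pverts = {0..<n}, parcs = {(x, y). x < n \<and> y < n \<and> (0 < x \<and> y = p x \<or> 0 < y \<and> x = p y)}\<rparr>"

text \<open>Parents decrease, so following them from any node ends in 0. On a cycle, both neighbors
  of the largest node would be its parent.\<close>

lemma tree_parent_graph:
  assumes p: "\<And>x. 0 < x \<Longrightarrow> p x < x" and n: "1 \<le> n"
  shows "tree_graph (parent_graph n p)"
proof -
  let ?G = "parent_graph n p"
  have pg: "pair_graph ?G"
  proof
    show "finite (parcs ?G)"
      by (rule finite_subset[of _ "{0..<n} \<times> {0..<n}"]) (auto simp: parent_graph_def)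
    show "symmetric ?G"
      by (auto simp: parent_graph_def symmetric_def sym_def)
    have "(x, x) \<notin> parcs ?G" for x
      using p[of x] by (cases "p x = x") (auto simp: parent_graph_def)
    then show "fst e \<noteq> snd e" if "e \<in> parcs ?G" for e
      using that by (metis prod.collapse)
  qed (auto simp: parent_graph_def)
  interpret pair_graph ?G by fact
  have adj: "(x, p x) \<in> parcs ?G" if "x < n" "0 < x" for x
    using that p[of x] by (auto simp: parent_graph_def)
  have root: "x \<rightarrow>\<^sup>*\<^bsub>with_proj ?G\<^esub> 0" if "x < n" for x
    using that
  proof (induction x rule: less_induct)
    case (less x)
    show ?case
    proof (cases "x = 0")
      case True
      with less have "x \<in> verts (with_proj ?G)" by (simp add: parent_graph_def)
      with True show ?thesis by simp
    next
      case False
      then have "p x \<rightarrow>\<^sup>*\<^bsub>with_proj ?G\<^esub> 0" using less p[of x] by auto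
      with adj[of x] less False show ?thesis
        by (auto intro: adj_reachable_trans)
    qed
  qed
  then have "x \<rightarrow>\<^sup>*\<^bsub>with_proj ?G\<^esub> y" if "x < n" "y < n" for x y
    using that by (meson reachable_trans symmetric_reachable pair_sym_arcs)
  then have "connected (with_proj ?G)"
    using n unfolding connected_def strongly_connected_def pverts_mk_symmetric with_proj_simps(1)
      reachable_mk_symmetric_eq[OF pair_sym_arcs]
    by (auto simp: parent_graph_def)
  moreover have False
    if c: "3 \<le> length c" "distinct c" "\<forall>i < length c. (c ! i, c ! (Suc i mod length c)) \<in> parcs ?G"
    for c
  proof -
    let ?m = "length c"
    have ne: "set c \<noteq> {}" using c(1) by auto
    obtain i where i: "i < ?m" "c ! i = Max (set c)"
      using Max_in[OF _ ne] by (metis List.finite_set in_set_conv_nth)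
    have max: "c ! j \<le> c ! i" if "j < ?m" for j
      using that i by simp
    have parent: "y = p x" if "(x, y) \<in> parcs ?G \<or> (y, x) \<in> parcs ?G" "y \<le> x" for x y
      using that p[of y] by (auto simp: parent_graph_def)
    \<comment> \<open>The positions before and after \<open>i\<close> on the cycle; they differ
      because the length is at least 3.\<close>
    define j where "j = (if i = 0 then ?m - 1 else i - 1)"
    define k where "k = Suc i mod ?m"
    have j: "j < ?m" "Suc j mod ?m = i" and k: "k < ?m" "k \<noteq> j"
      using i(1) c(1) by (auto simp: j_def k_def mod_Suc split: if_splits)
    have "c ! j = p (c ! i)"
      using parent max j c(3) by metis
    moreover have "c ! k = p (c ! i)"
      using parent max k c(3) i(1) unfolding k_def by metis
    ultimately show False
      using j k nth_eq_iff_index_eq[OF c(2), of j k] by simp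
  qed
  ultimately show ?thesis
    using pg unfolding tree_graph_def connected_graph_def by blast
qed

text \<open>\<open>\<delta>\<close> is a lower bound on the distance to a node with a different
  input: it vanishes there and exceeds its value at a neighbor by at most 1. Information travels one
  arc per round.\<close>

lemma node_state_indist:
  assumes "\<And>v. 0 < \<delta> v \<Longrightarrow> input I v = input I' v"
    and "\<And>u v. u \<in> nbrs (topology I) v \<Longrightarrow> \<delta> v \<le> Suc (\<delta> u)"
    and "topology I' = topology I" "id_bound I' = id_bound I" "ident I' = ident I"
    and "t < \<delta> v"
  shows "node_state A I t v = node_state A I' t v"
  using assms(6)
proof (induction t arbitrary: v)
  case 0
  then show ?case using assms by simp
next
  case (Suc t)
  have "node_state A I t u = node_state A I' t u" if "u \<in> nbrs (topology I) v" for u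
    using assms(2)[OF that] Suc.prems by (intro Suc.IH) simp
  moreover have "node_state A I t v = node_state A I' t v"
    using Suc.prems by (intro Suc.IH) simp
  ultimately show ?case
    using assms(3-5) by (simp cong: image_cong_simp)
qed

lemma output_label_indist:
  assumes "\<And>r. r \<le> t \<Longrightarrow> node_state A I r v = node_state A I' r v"
    and "has_output A I t v"
  shows "output_label A I v = output_label A I' v"
proof -
  let ?k = "LEAST t. has_output A I t v"
  have same: "has_output A I r v \<longleftrightarrow> has_output A I' r v" if "r \<le> t" for r
    using assms(1) that by (auto simp: has_output_def)
  have k: "has_output A I ?k v" "?k \<le> t"
    using assms(2) by (auto intro: LeastI Least_le)
  have "(LEAST t. has_output A I' t v) = ?k"
  proof (rule Least_equality)
    show "has_output A I' ?k v" using k same by blast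
    show "?k \<le> r" if "has_output A I' r v" for r
      using that same[of r] k(2) by (cases "r \<le> t") (auto intro: Least_le)
  qed
  then show ?thesis
    unfolding output_label_def using assms(1) k(2) by simp
qed

text \<open>The path \<open>0, \<dots>, T + 1\<close> with leaves attached such that \<open>0\<close> has at least \<open>m\<close> neighbors and
  \<open>i\<close> has \<open>d i\<close> neighbors for \<open>1 \<le> i \<le> T\<close>: the leaves of \<open>i\<close> are taken from the \<open>i\<close>-th of
  \<open>T + 1\<close> consecutive blocks of length \<open>m\<close>, and all superfluous nodes become leaves of \<open>0\<close>.\<close>

definition caterpillar_parent :: "nat \<Rightarrow> nat \<Rightarrow> (nat \<Rightarrow> nat) \<Rightarrow> nat \<Rightarrow> nat" where
  "caterpillar_parent T m d x =
     (if x \<le> T + 1 then x - 1 else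
        (let i = (x - (T + 2)) div m; j = (x - (T + 2)) mod m
         in if 1 \<le> i \<and> i \<le> T \<and> j < d i - 2 then i else 0))"

definition caterpillar :: "nat \<Rightarrow> nat \<Rightarrow> nat \<Rightarrow> (nat \<Rightarrow> nat) \<Rightarrow> ugraph" where
  "caterpillar n T m d = parent_graph n (caterpillar_parent T m d)"

lemma caterpillar_parent_le: "T + 1 < x \<Longrightarrow> caterpillar_parent T m d x \<le> T"
  by (auto simp: caterpillar_parent_def Let_def)

lemma caterpillar_parent_less: "0 < x \<Longrightarrow> caterpillar_parent T m d x < x"
  using caterpillar_parent_le[of T x m d] by (cases "x \<le> T + 1") (auto simp: caterpillar_parent_def)

text \<open>The path neighbors \<open>i - 1\<close> and \<open>i + 1\<close> account for 2 of the
  degree; the other \<open>d i - 2\<close> neighbors are the first nodes of block \<open>i\<close>,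
  which fits below \<open>n\<close>.\<close>

lemma caterpillar_degree:
  assumes i: "1 \<le> i" "i \<le> T" and d: "2 \<le> d i" "d i \<le> m" and n: "(T + 1) * m + T + 2 \<le> n"
  shows "card (nbrs (caterpillar n T m d) i) = d i"
proof -
  let ?f = "\<lambda>j. T + 2 + i * m + j"
  have m: "0 < m" using d by simp
  have "i * m \<le> T * m" using i by (intro mult_le_mono1)
  then have n': "i * m + m + T + 2 \<le> n" using n add_mult_distrib[of T 1 m] by linarith
  have "nbrs (caterpillar n T m d) i = {i - 1, i + 1} \<union> ?f ` {..<d i - 2}" (is "?L = ?R")
  proof (intro equalityI subsetI)
    fix x assume x: "x \<in> ?L"
    show "x \<in> ?R"
    proof (cases "x \<le> T + 1")
      case True
      then show ?thesis
        using x i by (auto simp: nbrs_def caterpillar_def parent_graph_def caterpillar_parent_def)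
    next
      case False
      let ?y = "x - (T + 2)"
      have "caterpillar_parent T m d i = i - 1" using i by (simp add: caterpillar_parent_def)
      then have "caterpillar_parent T m d x = i"
        using x False i by (auto simp: nbrs_def caterpillar_def parent_graph_def)
      then have y: "?y div m = i" "?y mod m < d i - 2"
        using False i by (auto simp: caterpillar_parent_def Let_def split: if_splits)
      have "?y = i * m + ?y mod m" using y(1) by (metis div_mult_mod_eq)
      then have "x = ?f (?y mod m)" using False by simp
      with y(2) show ?thesis by blast
    qed
  next
    fix x assume "x \<in> ?R"
    then consider "x = i - 1" | "x = i + 1" | j where "j < d i - 2" "x = ?f j" by blast
    then show "x \<in> ?L"
    proof cases
      case 3
      then have "caterpillar_parent T m d x = i" using i d by (simp add: caterpillar_parent_def)
      with 3 show ?thesis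
        using n' d i by (simp add: nbrs_def caterpillar_def parent_graph_def)
    qed (use i n' in \<open>auto simp: nbrs_def caterpillar_def parent_graph_def caterpillar_parent_def\<close>)
  qed
  moreover have "card ?R = card {i - 1, i + 1} + card (?f ` {..<d i - 2})"
    using i by (intro card_Un_disjoint) auto
  moreover have "card (?f ` {..<d i - 2}) = d i - 2"
    by (subst card_image) (auto simp: inj_on_def)
  ultimately show ?thesis using d i by simp
qed

text \<open>All \<open>m\<close> nodes of block 0 are attached to 0.\<close>

lemma caterpillar_degree_root:
  assumes "(T + 1) * m + T + 2 \<le> n"
  shows "m \<le> card (nbrs (caterpillar n T m d) 0)"
proof -
  have "(\<lambda>j. T + 2 + j) ` {..<m} \<subseteq> nbrs (caterpillar n T m d) 0"
    using assms by (auto simp: nbrs_def caterpillar_def parent_graph_def caterpillar_parent_def)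
  moreover have "finite (nbrs (caterpillar n T m d) 0)"
    by (rule finite_subset[of _ "{0..<n}"]) (auto simp: nbrs_def caterpillar_def parent_graph_def)
  ultimately have "card ((\<lambda>j. T + 2 + j) ` {..<m}) \<le> card (nbrs (caterpillar n T m d) 0)"
    by (intro card_mono)
  then show ?thesis by (subst (asm) card_image) (auto simp: inj_on_def)
qed

section \<open>The round lower bound on caterpillars\<close>

lemma unit_jumps_attain:
  fixes s :: "nat \<Rightarrow> nat"
  assumes "s 0 = 0" "\<And>n. s (Suc n) \<le> Suc (s n)" "l \<le> s m"
  obtains d where "s d = l"
proof -
  have "\<exists>d. s d = l" using assms(3)
  proof (induction m)
    case (Suc m)
    show ?case
    proof (cases "l \<le> s m")
      case False
      then have "s (Suc m) = l" using Suc.prems assms(2)[of m] by simp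
      then show ?thesis by blast
    qed (rule Suc.IH)
  qed (use assms(1) in auto)
  with that show ?thesis by blast
qed

text \<open>Levels decrease along the path away from 0, so changing the input of 0 alone flips the
  required output of \<open>T\<close>, which is \<open>T\<close> arcs away. Taking 3 off
  \<open>s m\<close> keeps the levels of nodes 1 to \<open>T\<close> at least 3.\<close>

lemma rounds_lower:
  fixes s :: "nat \<Rightarrow> nat"
  assumes s: "mono s" "s 0 = 0" "\<And>n. s (Suc n) \<le> Suc (s n)"
    and B: "poly_bounds B"
    and C: "\<And>G. tree_graph G \<Longrightarrow> C G"
    and A: "solves A (level_problem s) C B"
    and n: "(m + 1)\<^sup>2 \<le> n" and T: "T = s m - 3" "1 \<le> T"
  shows "enat T \<le> round_complexity A (level_problem s) C B n"
proof -
  have s_le: "s k \<le> k" for k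
  proof (induction k)
    case (Suc k)
    then show ?case using s(3)[of k] by linarith
  qed (simp add: s)
  have Tm: "T + 3 \<le> m" using s_le[of m] T by simp
  have "(T + 1) * m + T + 2 \<le> (m + 1)\<^sup>2"
  proof -
    have "(T + 1) * m \<le> m * m" using Tm by (intro mult_right_mono) auto
    then show ?thesis using Tm by (simp add: power2_eq_square)
  qed
  then have n': "(T + 1) * m + T + 2 \<le> n" using n by simp
  \<comment> \<open>Unit jumps make \<open>s\<close> attain every value up to \<open>s m\<close>, so
    each prescribed level is the level of some degree.\<close>
  have "\<exists>d. \<forall>i. s (d i) = s m - i"
  proof (rule choice, rule allI)
    fix i show "\<exists>x. s x = s m - i"
      using unit_jumps_attain[of s "s m - i" m] s by (metis diff_le_self)
  qed
  then obtain d where sd: "\<And>i. s (d i) = s m - i" by blast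
  have d: "2 \<le> d i \<and> d i \<le> m" if "1 \<le> i" "i \<le> T" for i
  proof -
    \<comment> \<open>By \<open>s k \<le> k\<close>, level 3 forces degree at least 3, which leaves
      room for the two path neighbors.\<close>
    have "3 \<le> s (d i)" "s (d i) < s m" using sd[of i] that T by auto
    moreover have "d i \<le> m" using \<open>s (d i) < s m\<close> s(1) by (meson monoD nat_le_linear not_le)
    ultimately show ?thesis using s_le[of "d i"] by linarith
  qed
  define G where "G = caterpillar n T m d"
  obtain N where N: "N \<in> B n" "n \<le> N"
    using B n unfolding poly_bounds_def
    by (metis One_nat_def Suc_leI add_gr_0 all_not_in_conv le_trans less_numeral_extra(1) zero_less_power)
  \<comment> \<open>Two networks that differ only in the input of node 0; the names, all below
    \<open>n \<le> N\<close>, serve as identifiers.\<close>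
  define I where "I b = \<lparr>topology = G, id_bound = N, ident = id,
      input = \<lambda>v. of_bool (b \<and> v = 0)\<rparr>" for b
  have tree: "tree_graph G"
    unfolding G_def caterpillar_def using caterpillar_parent_less n'
    by (intro tree_parent_graph) auto
  then have pg: "pair_graph G" by (simp add: tree_graph_def connected_graph_def)
  have pverts: "pverts G = {0..<n}"
    by (simp add: G_def caterpillar_def parent_graph_def)
  have I: "I b \<in> networks C B (in_labels (level_problem s)) n" for b
    using tree C[OF tree] N unfolding networks_def I_def
    by (auto simp: pverts tree_graph_def)
  define q where "q b v \<longleftrightarrow> output_label A (I b) v = 1" for b v
  have q: "q b v \<longleftrightarrow> (b \<and> v = 0) \<or> (\<exists>u \<in> higher_nbrs s G v. q b u)" if "v < n" for b v
  proof -
    have "good_ball (level_problem s) (graph_ball G 2 v) v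
        (\<lambda>u. (input (I b) u, output_label A (I b) u))"
      using A I[of b] that unfolding solves_def by (fastforce simp: I_def pverts)
    moreover have "input (I b) v = 1 \<longleftrightarrow> b \<and> v = 0" by (simp add: I_def)
    ultimately show ?thesis
      by (simp add: higher_nbrs_graph_ball q_def)
  qed
  have level: "s m - i \<le> s (card (nbrs G i)) \<and> (1 \<le> i \<longrightarrow> s (card (nbrs G i)) = s m - i)"
    if "i \<le> T" for i
  proof (cases "i = 0")
    case True
    then show ?thesis
      using caterpillar_degree_root[OF n', of d] s(1) by (auto simp: G_def dest: monoD)
  next
    case False
    then have "card (nbrs G i) = d i"
      unfolding G_def using that d n' by (intro caterpillar_degree) auto
    then show ?thesis by (simp add: sd)
  qed
  have "q True i" if "i \<le> T" for i
    using that
  proof (induction i)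
    case 0
    then show ?case using q[of 0 True] n' by simp
  next
    case (Suc i)
    have "i \<in> nbrs G (Suc i)"
      using Suc.prems n'
      by (auto simp: nbrs_def G_def caterpillar_def parent_graph_def caterpillar_parent_def)
    then have "i \<in> higher_nbrs s G (Suc i)"
      using level[of i] level[of "Suc i"] Suc.prems T by (auto simp: higher_nbrs_def)
    then show ?case using q[of "Suc i" True] Suc n' by auto
  qed
  then have q1: "q True T" by simp
  \<comment> \<open>Without any input 1, an output 1 needs a higher neighbor with output 1. Levels
    are at most \<open>n\<close>, so this descent ends.\<close>
  have q0: "\<not> q False v" if "v < n" for v
    using that
  proof (induction "n - s (card (nbrs G v))" arbitrary: v rule: less_induct)
    case less
    show ?case
    proof
      assume "q False v"
      then obtain u where u: "u \<in> nbrs G v" "s (card (nbrs G v)) < s (card (nbrs G u))" "q False u"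
        using q[OF less.prems, of False] by (auto simp: higher_nbrs_def)
      have "u < n" using u(1) pair_graph_nbrs(1)[OF pg, of v] pverts by auto
      have "card (nbrs G u) \<le> n"
        using card_mono[OF _ pair_graph_nbrs(1)[OF pg, of u]] by (simp add: pverts)
      then have "s (card (nbrs G u)) \<le> n" using s_le le_trans by blast
      with u(2) have "n - s (card (nbrs G u)) < n - s (card (nbrs G v))"
        by (intro diff_less_mono2) simp_all
      then show False using less.hyps u(3) \<open>u < n\<close> by blast
    qed
  qed
  \<comment> \<open>The distance from node 0 in the caterpillar; it is \<open>T\<close> at node
    \<open>T\<close>.\<close>
  define \<delta> where "\<delta> x = (if x \<le> T + 1 then x else caterpillar_parent T m d x + 1)" for x
  have indist: "node_state A (I True) t v = node_state A (I False) t v" if "t < \<delta> v" for t v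
  proof (rule node_state_indist[where \<delta> = \<delta>])
    fix u v assume "u \<in> nbrs (topology (I True)) v"
    then have "0 < v \<and> u = caterpillar_parent T m d v \<or> 0 < u \<and> v = caterpillar_parent T m d u"
      by (simp add: nbrs_def I_def G_def caterpillar_def parent_graph_def)
    moreover have "\<delta> x \<le> Suc (\<delta> (caterpillar_parent T m d x)) \<and>
        \<delta> (caterpillar_parent T m d x) \<le> Suc (\<delta> x)" for x
    proof (cases "x \<le> T + 1")
      case True
      then have "x - 1 \<le> T + 1" "caterpillar_parent T m d x = x - 1"
        by (simp_all add: caterpillar_parent_def)
      with True show ?thesis by (simp add: \<delta>_def) arith
    next
      case False
      then show ?thesis using caterpillar_parent_le[of T x m d] by (simp add: \<delta>_def)
    qed
    ultimately show "\<delta> v \<le> Suc (\<delta> u)" by blast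
  qed (use that in \<open>auto simp: I_def \<delta>_def split: if_splits\<close>)
  have no_output: "\<not> has_output A (I True) t T" if "t < T" for t
  proof
    assume "has_output A (I True) t T"
    moreover have "node_state A (I True) r T = node_state A (I False) r T" if "r \<le> t" for r
      using that \<open>t < T\<close> by (intro indist) (simp add: \<delta>_def)
    ultimately have "output_label A (I True) T = output_label A (I False) T"
      by (intro output_label_indist) auto
    then show False using q1 q0[of T] n' by (auto simp: q_def)
  qed
  have "T \<in> pverts G" using n' by (simp add: pverts)
  then have "enat T \<le> rounds A (I True)"
    unfolding rounds_def using no_output
    by (intro INF_greatest) (fastforce simp: I_def not_less[symmetric])
  also have "\<dots> \<le> round_complexity A (level_problem s) C B n"
    unfolding round_complexity_def by (intro SUP_upper I)
  finally show ?thesis .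
qed

lemma level_problem_lower:
  fixes s :: "nat \<Rightarrow> nat"
  assumes s: "mono s" "s 0 = 0" "\<And>n. s (Suc n) \<le> Suc (s n)"
      "\<And>n. s (n\<^sup>2) \<le> D * s n + D" "filterlim s at_top sequentially"
    and B: "poly_bounds B"
    and C: "\<And>G. tree_graph G \<Longrightarrow> C G"
  shows "requires (level_problem s) C B (\<lambda>n. real (s n))"
  unfolding requires_def
proof (intro allI impI)
  fix A assume A: "solves A (level_problem s) C B"
  define m where "m n = floor_sqrt n - 1" for n
  define T where "T n = s (m n) - 3" for n
  have "enat (T n) \<le> round_complexity A (level_problem s) C B n" for n
  proof (cases "1 \<le> T n")
    case True
    \<comment> \<open>As \<open>s 0 = 0\<close>, a positive \<open>T n\<close> excludes
      \<open>m n = 0\<close>, so the subtraction in \<open>m\<close> is not truncated.\<close>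
    then have "m n \<noteq> 0" using s(2) by (intro notI) (simp add: T_def)
    then have "m n + 1 = floor_sqrt n" by (simp add: m_def)
    then have "(m n + 1)\<^sup>2 \<le> n" by simp
    then show ?thesis
      using True by (intro rounds_lower[OF s(1-3) B C A]) (auto simp: T_def)
  next
    case False
    then have "T n = 0" by simp
    then show ?thesis by (simp flip: zero_enat_def)
  qed
  moreover have "(\<lambda>n. real (T n)) \<in> \<Omega>(\<lambda>n. real (s n))"
  proof -
    \<comment> \<open>Exponent 4 suffices because \<open>n < (m n + 2)^2 \<le> m n ^ 4\<close> when
      \<open>m n \<ge> 2\<close>, which \<open>n \<ge> 9\<close> ensures.\<close>
    obtain K where K: "\<And>n. s (n ^ 2 ^ 2) \<le> K * s n + K"
      using square_growth_iterate[of s D] s(4) by blast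
    \<comment> \<open>For positive \<open>K\<close> this threshold forces
      \<open>s (m n) \<ge> 4\<close>, whence
      \<open>s (m n) + 1 = T n + 4 \<le> 5 * T n\<close>.\<close>
    have "\<forall>\<^sub>F n in sequentially. 5 * K \<le> s n"
      using s(5) by (simp add: filterlim_at_top)
    then have "\<forall>\<^sub>F n in sequentially. norm (real (s n)) \<le> real (5 * K) * norm (real (T n))"
      using eventually_ge_at_top[of 9]
    proof eventually_elim
      case (elim n)
      have "3 \<le> floor_sqrt n"
        using mono_floor_sqrt'[OF elim(2)] floor_sqrt_inverse_power2[of 3] by simp
      then have m: "2 \<le> m n" by (simp add: m_def)
      have "Suc (floor_sqrt n) = m n + 2" using m by (simp add: m_def)
      then have "n < (m n + 2)\<^sup>2"
        using Suc_floor_sqrt_power2_gt[of n] by simp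
      also have "\<dots> \<le> ((m n)\<^sup>2)\<^sup>2"
      proof (rule power_mono)
        have "2 * m n \<le> m n * m n" using m by (intro mult_right_mono) auto
        then show "m n + 2 \<le> (m n)\<^sup>2" unfolding power2_eq_square using m by linarith
      qed simp
      also have "\<dots> = m n ^ 2 ^ 2" by (simp flip: power_mult)
      finally have "s n \<le> K * s (m n) + K"
        using K[of "m n"] s(1) by (meson less_imp_le monoD order_trans)
      then have le: "s n \<le> K * (s (m n) + 1)" by simp
      show ?case
      proof (cases "K = 0")
        case False
        have "K * 5 \<le> K * (s (m n) + 1)" using le elim(1) by linarith
        then have "5 \<le> s (m n) + 1" using False by (simp only: mult_le_cancel1)
        then have "s (m n) + 1 \<le> 5 * T n" by (simp add: T_def)
        then have "s n \<le> K * (5 * T n)" using le by (meson le_trans mult_le_mono2)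
        then have "real (s n) \<le> real (K * (5 * T n))" by (simp only: of_nat_le_iff)
        then show ?thesis by (simp add: ac_simps)
      qed (use le in simp)
    qed
    then have "(\<lambda>n. real (s n)) \<in> O(\<lambda>n. real (T n))" by (rule bigoI)
    then show ?thesis by (simp add: bigomega_iff_bigo)
  qed
  ultimately show "\<exists>T. (\<forall>n. enat (T n) \<le> round_complexity A (level_problem s) C B n) \<and>
      (\<lambda>n. real (T n)) \<in> \<Omega>(\<lambda>n. real (s n))"
    by blast
qed

section \<open>From level functions to given complexities\<close>

lemma solvable_in_bigtheta:
  assumes "g \<in> \<Theta>(f)" "solvable_in P C B f"
  shows "solvable_in P C B g"
  using assms(2) landau_o.big.cong_bigtheta[OF assms(1)] unfolding solvable_in_def by simp

lemma requires_bigtheta: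
  assumes "g \<in> \<Theta>(f)" "requires P C B f"
  shows "requires P C B g"
  using assms(2) landau_omega.big.cong_bigtheta[OF assms(1)] unfolding requires_def by simp

text \<open>Reduces the theorem to the choice of \<open>s\<close>. The lower bound holds on every
  class containing all trees, which covers both the general bound and the one for trees.\<close>

lemma problem_of_level_function:
  fixes s :: "nat \<Rightarrow> nat"
  assumes "mono s" "s 0 = 0" "\<And>n. s (Suc n) \<le> Suc (s n)"
      "\<And>n. s (n\<^sup>2) \<le> D * s n + D" "filterlim s at_top sequentially"
    and "t \<in> \<Theta>(\<lambda>n. real (s n))"
  shows "\<exists>P. locally_checkable P \<and> has_complexity_Theta P t \<and> lower_bound_for_trees P t"
proof (intro exI conjI)
  show "locally_checkable (level_problem s)" by (rule locally_checkable_level_problem)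
  have lower: "requires (level_problem s) C B t"
    if "poly_bounds B" "\<And>G. tree_graph G \<Longrightarrow> C G" for B C
    using level_problem_lower[OF assms(1-5) that] by (rule requires_bigtheta[OF assms(6)])
  have upper: "solvable_in (level_problem s) C B t" if "poly_bounds B" for B C
    using level_problem_upper[OF assms(1,4,5) that] by (rule solvable_in_bigtheta[OF assms(6)])
  show "has_complexity_Theta (level_problem s) t"
    unfolding has_complexity_Theta_def using lower upper by simp
  show "lower_bound_for_trees (level_problem s) t"
    unfolding lower_bound_for_trees_def using lower by simp
qed

section \<open>Level functions\<close>

lemma filterlim_nat_floor:
  fixes f :: "nat \<Rightarrow> real"
  assumes "filterlim f at_top sequentially"
    and "\<forall>\<^sub>F n in sequentially. real (s n) \<le> f n \<and> f n < real (s n) + 1"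
  shows "filterlim s at_top sequentially" "f \<in> \<Theta>(\<lambda>n. real (s n))"
proof -
  show lim: "filterlim s at_top sequentially"
    unfolding filterlim_at_top
  proof
    fix Z
    have "\<forall>\<^sub>F n in sequentially. real Z + 1 \<le> f n"
      using assms(1) by (simp add: filterlim_at_top)
    with assms(2) show "\<forall>\<^sub>F n in sequentially. Z \<le> s n"
      by eventually_elim linarith
  qed
  then have ev: "\<forall>\<^sub>F n in sequentially. 1 \<le> s n"
    by (simp add: filterlim_at_top)
  show "f \<in> \<Theta>(\<lambda>n. real (s n))"
  proof (rule bigthetaI')
    show "\<forall>\<^sub>F n in sequentially. 1 * norm (real (s n)) \<le> norm (f n) \<and>
        norm (f n) \<le> 2 * norm (real (s n))"
      using assms(2) ev
    proof eventually_elim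
      case (elim n)
      then have "1 \<le> real (s n)" by simp
      with elim show ?case by simp
    qed
  qed simp_all
qed

subsection \<open>Powers of the logarithm\<close>

text \<open>Subadditivity of a concave power: after division by \<open>x + 1\<close> both summands
  lie in [0,1], where \<open>u \<le> u powr e\<close>.\<close>

lemma powr_add_one_le:
  fixes x e :: real
  assumes "0 \<le> x" "0 < e" "e < 1"
  shows "(x + 1) powr e \<le> x powr e + 1"
proof -
  let ?y = "x + 1"
  have *: "u \<le> u powr e" if "0 \<le> u" "u \<le> 1" for u :: real
    using that powr_mono'[of e 1 u] assms by simp
  have "1 = x / ?y + 1 / ?y" using assms by (simp add: field_simps)
  also have "\<dots> \<le> (x / ?y) powr e + (1 / ?y) powr e"
    using assms by (intro add_mono *) auto
  also have "\<dots> = (x powr e + 1) / ?y powr e"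
    using assms by (simp add: powr_divide add_divide_distrib)
  finally show ?thesis using assms by (simp add: field_simps)
qed

lemma log_powr_problem:
  fixes e :: real
  assumes e: "0 < e" "e < 1"
  shows "\<exists>P. locally_checkable P \<and> has_complexity_Theta P (\<lambda>n. log 2 (real n) powr e) \<and>
           lower_bound_for_trees P (\<lambda>n. log 2 (real n) powr e)"
proof -
  define f where "f n = log 2 (real n) powr e" for n :: nat
  define s where "s n = nat \<lfloor>f n\<rfloor>" for n
  have f0: "0 \<le> f n" for n by (simp add: f_def)
  have sf: "real (s n) \<le> f n \<and> f n < real (s n) + 1" for n
    using f0[of n] unfolding s_def by linarith
  have "mono f"
  proof (rule monoI)
    fix a b :: nat assume "a \<le> b"
    show "f a \<le> f b"
    proof (cases "a = 0")
      case True
      \<comment> \<open>By convention \<open>log 2 0\<close> is 0, and hence \<open>f 0\<close> is 0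
        too.\<close>
      then show ?thesis by (simp add: f_def log_def)
    next
      case False
      then show ?thesis
        using \<open>a \<le> b\<close> e unfolding f_def by (intro powr_mono2) auto
    qed
  qed
  then have mono: "mono s"
    unfolding s_def mono_def by (auto intro: nat_mono floor_mono)
  have s0: "s 0 = 0" by (simp add: s_def f_def log_def)
  have jump: "s (Suc n) \<le> Suc (s n)" for n
  proof (cases "n = 0")
    case False
    have "log 2 (real (Suc n)) \<le> log 2 (2 * real n)"
      using False by (subst log_le_cancel_iff) auto
    also have "\<dots> = log 2 (real n) + 1" using False by (simp add: log_mult)
    finally have "f (Suc n) \<le> (log 2 (real n) + 1) powr e"
      using False e unfolding f_def by (intro powr_mono2) auto
    also have "\<dots> \<le> f n + 1"
      using False e unfolding f_def by (intro powr_add_one_le) auto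
    finally show ?thesis using sf[of n] sf[of "Suc n"] by linarith
  qed (simp add: s_def f_def)
  have square: "s (n\<^sup>2) \<le> 2 * s n + 2" for n
  proof (cases "n = 0")
    case False
    have "f (n\<^sup>2) = 2 powr e * f n"
      using False by (simp add: f_def log_nat_power powr_mult)
    also have "\<dots> \<le> 2 * f n"
      using e f0[of n] powr_mono[of e 1 2] by (intro mult_right_mono) auto
    finally show ?thesis using sf[of n] sf[of "n\<^sup>2"] by linarith
  qed (simp add: s0)
  have "filterlim f at_top sequentially"
    unfolding f_def using e by real_asymp
  from filterlim_nat_floor[OF this, of s] sf
  have "filterlim s at_top sequentially" "f \<in> \<Theta>(\<lambda>n. real (s n))" by auto
  from problem_of_level_function[OF mono s0 jump square this] show ?thesis
    unfolding f_def .
qed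

subsection \<open>Iterated logarithms\<close>

lemma floor_log_Suc_le: "floor_log (Suc n) \<le> Suc (floor_log n)"
proof (cases "n = 0")
  case False
  have "floor_log (Suc n) \<le> floor_log (2 * n)" using False by (intro floor_log_le_iff) simp
  with False show ?thesis by simp
qed simp

text \<open>For positive \<open>n\<close>, appending a binary digit raises \<open>floor_log\<close>
  by 1. The form \<open>2 * x + 1\<close> thus survives each further logarithm in the induction for
  squares.\<close>

lemma floor_log_affine_le: "floor_log (2 * n + 1) \<le> 2 * floor_log n + 1"
  by (cases "n = 0") (simp_all add: floor_log_rec)

lemma iter_log_Suc: "iter_log (Suc k) x = log 2 (iter_log k x)"
  by (simp add: iter_log_def)

lemma iter_log_at_top: "filterlim (\<lambda>n. iter_log k (real n)) at_top sequentially"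
proof (induction k)
  case 0
  then show ?case by (simp add: iter_log_def filterlim_real_sequentially)
next
  case (Suc k)
  have "filterlim (log 2) at_top (at_top :: real filter)" by real_asymp
  from filterlim_compose[OF this Suc] show ?case by (simp add: iter_log_Suc)
qed

text \<open>Rounding down before or after \<open>log 2\<close> makes no difference, since powers of
  2 with natural exponents are integers. The statement is eventual so that the arguments of the
  logarithms are at least 1.\<close>

lemma floor_iter_log:
  "\<forall>\<^sub>F n in sequentially. real ((floor_log ^^ k) n) \<le> iter_log k (real n) \<and>
     iter_log k (real n) < real ((floor_log ^^ k) n) + 1"
proof (induction k)
  case (Suc k)
  have "\<forall>\<^sub>F n in sequentially. 1 \<le> iter_log k (real n)"
    using iter_log_at_top[of k] by (simp add: filterlim_at_top)
  with Suc show ?case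
  proof eventually_elim
    case (elim n)
    define x a where "x = iter_log k (real n)" and "a = (floor_log ^^ k) n"
    have xa: "real a \<le> x" "x < real a + 1" "1 \<le> x" using elim by (auto simp: x_def a_def)
    then have a: "1 \<le> a" by linarith
    have "real (floor_log a) = log 2 (2 powr real (floor_log a))" by simp
    also have "\<dots> \<le> log 2 x"
    proof -
      have "2 powr real (floor_log a) = real (2 ^ floor_log a)" by (simp add: powr_realpow)
      also have "\<dots> \<le> real a" using floor_log_exp2_le[of a] a by (simp only: of_nat_le_iff)
      finally show ?thesis using xa by (subst log_le_cancel_iff) auto
    qed
    finally have 1: "real (floor_log a) \<le> log 2 x" .
    \<comment> \<open>Both sides are integers, so the strict bound on \<open>a\<close> extends to
      every real \<open>x < a + 1\<close>.\<close>
    have "a + 1 \<le> 2 * 2 ^ floor_log a" using floor_log_exp2_gt[of a] by simp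
    then have "real (a + 1) \<le> real (2 * 2 ^ floor_log a)" by (simp only: of_nat_le_iff)
    then have "x < 2 powr (real (floor_log a) + 1)"
      using xa by (simp add: powr_add powr_realpow)
    then have "log 2 x < real (floor_log a) + 1"
      using xa by (subst log_less_iff) auto
    with 1 show ?case by (simp add: iter_log_Suc x_def a_def)
  qed
qed (simp add: iter_log_def)

lemma iter_log_problem:
  assumes "1 \<le> k"
  shows "\<exists>P. locally_checkable P \<and> has_complexity_Theta P (\<lambda>n. iter_log k (real n)) \<and>
           lower_bound_for_trees P (\<lambda>n. iter_log k (real n))"
proof -
  let ?s = "floor_log ^^ k"
  have mono: "mono ?s"
    by (rule mono_pow) (rule floor_log_mono)
  have s0: "?s 0 = 0" by (induction k) auto
  have jump: "?s (Suc n) \<le> Suc (?s n)" for n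
  proof (induction k)
    case (Suc k)
    then have "floor_log ((floor_log ^^ k) (Suc n)) \<le> floor_log (Suc ((floor_log ^^ k) n))"
      by (rule floor_log_le_iff)
    also have "\<dots> \<le> Suc (floor_log ((floor_log ^^ k) n))" by (rule floor_log_Suc_le)
    finally show ?case by simp
  qed simp
  \<comment> \<open>The induction starts at \<open>k = 1\<close>, since for \<open>k = 0\<close>
    squaring has no linear bound.\<close>
  have "?s (n\<^sup>2) \<le> 2 * ?s n + 1" for n
    using assms
  proof (induction k rule: dec_induct)
    case base
    have "floor_log (n\<^sup>2) \<le> 2 * floor_log n + 1"
    proof (cases "n = 0")
      case False
      have "n\<^sup>2 < (2 * 2 ^ floor_log n)\<^sup>2"
        using floor_log_exp2_gt[of n] by (intro power_strict_mono) auto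
      also have "\<dots> = 2 ^ (2 * floor_log n + 2)"
        by (simp add: power_mult_distrib power_add flip: power_mult)
      finally have "2 ^ floor_log (n\<^sup>2) < (2::nat) ^ (2 * floor_log n + 2)"
        using floor_log_exp2_le[of "n\<^sup>2"] False by (meson le_less_trans zero_less_power gr0I)
      then have "floor_log (n\<^sup>2) < 2 * floor_log n + 2"
        by (rule power_less_imp_less_exp[rotated]) simp
      then show ?thesis by simp
    qed simp
    then show ?case by simp
  next
    case (step k)
    have "floor_log ((floor_log ^^ k) (n\<^sup>2)) \<le> floor_log (2 * (floor_log ^^ k) n + 1)"
      using step by (intro floor_log_le_iff)
    also have "\<dots> \<le> 2 * floor_log ((floor_log ^^ k) n) + 1"
      by (rule floor_log_affine_le)
    finally show ?case by simp
  qed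
  then have square: "?s (n\<^sup>2) \<le> 2 * ?s n + 2" for n
    by (meson le_trans add_le_mono order_refl one_le_numeral)
  from problem_of_level_function[OF mono s0 jump square
      filterlim_nat_floor[OF iter_log_at_top floor_iter_log]]
  show ?thesis .
qed

subsection \<open>The function \<open>log_star\<close>\<close>

lemma iter_log_Suc': "iter_log (Suc k) x = iter_log k (log 2 x)"
  by (simp add: iter_log_def funpow_Suc_right del: funpow.simps)

text \<open>The count may drop to \<open>j\<close>: monotonicity of the logarithm is available only
  while the smaller value exceeds 1, and the process stops for \<open>x\<close> as soon as it does
  not.\<close>

lemma iter_log_le_one_mono:
  assumes "x \<le> y" "iter_log k y \<le> 1"
  shows "\<exists>j \<le> k. iter_log j x \<le> 1"
  using assms
proof (induction k arbitrary: x y)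
  case 0
  then show ?case by (auto simp: iter_log_def)
next
  case (Suc k)
  show ?case
  proof (cases "x \<le> 1")
    case True
    then show ?thesis by (intro exI[of _ 0]) (simp add: iter_log_def)
  next
    case False
    then have "log 2 x \<le> log 2 y" using Suc.prems by simp
    with Suc obtain j where "j \<le> k" "iter_log j (log 2 x) \<le> 1"
      by (auto simp: iter_log_Suc')
    then show ?thesis by (intro exI[of _ "Suc j"]) (simp add: iter_log_Suc')
  qed
qed

lemma iter_log_power: "iter_log (Suc k) (real (2 ^ n)) = iter_log k (real n)"
  by (simp add: iter_log_Suc' log_nat_power)

lemma ex_iter_log_le_one: "\<exists>k. iter_log k (real n) \<le> 1"
proof (induction n rule: less_induct)
  case (less n)
  show ?case
  proof (cases "n \<le> 1")
    case True
    then show ?thesis by (intro exI[of _ 0]) (simp add: iter_log_def)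
  next
    case False
    then obtain k where k: "iter_log k (real (n - 1)) \<le> 1" using less[of "n - 1"] by auto
    \<comment> \<open>One logarithm takes \<open>2 ^ (n - 1)\<close> to \<open>n - 1\<close>, which
      the induction hypothesis covers.\<close>
    have "n \<le> 2 ^ (n - 1)" using False less_exp[of "n - 1"] by linarith
    then have "real n \<le> real (2 ^ (n - 1))" by (simp only: of_nat_le_iff)
    with k iter_log_le_one_mono[of "real n" "real (2 ^ (n - 1))" "Suc k"] show ?thesis
      unfolding iter_log_power by auto
  qed
qed

lemma iter_log_log_star: "iter_log (log_star n) (real n) \<le> 1"
  unfolding log_star_def using ex_iter_log_le_one by (rule LeastI_ex)

lemma log_star_le: "iter_log k (real n) \<le> 1 \<Longrightarrow> log_star n \<le> k"
  unfolding log_star_def by (rule Least_le)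

lemma log_star_mono: "m \<le> n \<Longrightarrow> log_star m \<le> log_star n"
  using iter_log_le_one_mono[OF _ iter_log_log_star, of "real m" n] log_star_le
  by (meson le_trans of_nat_mono)

text \<open>The power is at least 2, so a first logarithm is necessary, and it leads to
  \<open>n\<close>. The equation fails for \<open>n = 0\<close>, as \<open>log_star\<close> is 0 at
  both 0 and 1.\<close>

lemma log_star_power:
  assumes "1 \<le> n"
  shows "log_star (2 ^ n) = Suc (log_star n)"
proof (rule antisym)
  show "log_star (2 ^ n) \<le> Suc (log_star n)"
    by (rule log_star_le) (unfold iter_log_power, rule iter_log_log_star)
  have "log_star (2 ^ n) \<noteq> 0"
  proof
    assume "log_star (2 ^ n) = 0"
    then have "(2::real) ^ n \<le> 1" using iter_log_log_star[of "2 ^ n"] by (simp add: iter_log_def)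
    moreover have "(2::real) ^ 1 \<le> 2 ^ n" using assms by (intro power_increasing) auto
    ultimately show False by simp
  qed
  then obtain k where k: "log_star (2 ^ n) = Suc k" using not0_implies_Suc by blast
  have "iter_log k (real n) \<le> 1"
    using iter_log_log_star[of "2 ^ n"] unfolding k iter_log_power .
  then show "Suc (log_star n) \<le> log_star (2 ^ n)"
    unfolding k using log_star_le by blast
qed

lemma log_star_problem:
  "\<exists>P. locally_checkable P \<and> has_complexity_Theta P (\<lambda>n. real (log_star n)) \<and>
     lower_bound_for_trees P (\<lambda>n. real (log_star n))"
proof -
  have mono: "mono log_star" by (intro monoI log_star_mono)
  have s0: "log_star 0 = 0" "log_star 1 = 0"
    using log_star_le[of 0 0] log_star_le[of 0 1] by (auto simp: iter_log_def)
  have jump: "log_star (Suc n) \<le> Suc (log_star n)" for n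
  proof (cases "n = 0")
    case False
    \<comment> \<open>One exponential exceeds the successor and raises \<open>log_star\<close> by
      exactly 1.\<close>
    have "log_star (Suc n) \<le> log_star (2 ^ n)" by (intro log_star_mono Suc_leI less_exp)
    with False show ?thesis by (simp add: log_star_power)
  qed (use s0 in simp)
  have square: "log_star (n\<^sup>2) \<le> 2 * log_star n + 2" for n
  proof (cases "n = 0")
    case False
    have "2 * n \<le> 2 ^ n"
    proof -
      have "n \<le> 2 ^ (n - 1)" using less_exp[of "n - 1"] by linarith
      then have "2 * n \<le> 2 * 2 ^ (n - 1)" by simp
      also have "\<dots> = 2 ^ n" using False by (simp flip: power_Suc)
      finally show ?thesis .
    qed
    \<comment> \<open>Two exponentials dominate the square, so \<open>log_star\<close> grows by at
      most 2.\<close>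
    have "n\<^sup>2 \<le> (2 ^ n)\<^sup>2" by (intro power_mono less_imp_le[OF less_exp]) simp
    also have "\<dots> = 2 ^ (2 * n)" by (simp add: mult.commute flip: power_mult)
    also have "\<dots> \<le> 2 ^ 2 ^ n" using \<open>2 * n \<le> 2 ^ n\<close> by (intro power_increasing) auto
    finally have "log_star (n\<^sup>2) \<le> log_star (2 ^ 2 ^ n)" by (rule log_star_mono)
    also have "\<dots> = log_star n + 2" using False by (simp add: log_star_power)
    finally show ?thesis by simp
  qed (use s0 in simp)
  \<comment> \<open>Towers of exponentials make \<open>log_star\<close> unbounded.\<close>
  have "\<exists>n. k \<le> log_star n \<and> 1 \<le> n" for k
  proof (induction k)
    case (Suc k)
    then obtain n where "k \<le> log_star n" "1 \<le> n" by blast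
    then show ?case by (intro exI[of _ "2 ^ n"]) (simp add: log_star_power)
  qed auto
  then have "filterlim log_star at_top sequentially"
    unfolding filterlim_at_top eventually_sequentially by (meson le_trans log_star_mono)
  from problem_of_level_function[OF mono s0(1) jump square this bigtheta_refl] show ?thesis .
qed

theorem theorem9:
  shows
    "(\<exists>P. locally_checkable P \<and>
        has_complexity_Theta P (\<lambda>n. real (log_star n)) \<and>
        lower_bound_for_trees P (\<lambda>n. real (log_star n))) \<and>
     (\<forall>\<epsilon>::real. 0 < \<epsilon> \<and> \<epsilon> < 1 \<longrightarrow>
        (\<exists>P. locally_checkable P \<and>
           has_complexity_Theta P (\<lambda>n. log 2 (real n) powr \<epsilon>) \<and>
           lower_bound_for_trees P (\<lambda>n. log 2 (real n) powr \<epsilon>))) \<and>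
     (\<forall>k::nat. 1 \<le> k \<longrightarrow>
        (\<exists>P. locally_checkable P \<and>
           has_complexity_Theta P (\<lambda>n. iter_log k (real n)) \<and>
           lower_bound_for_trees P (\<lambda>n. iter_log k (real n))))"
  using log_star_problem log_powr_problem iter_log_problem by blast

end
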